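(* For any values of $N$, $B$, and $D$, there is a fixed-topology binary tree on $N$ nodes such that every external-memory layout of it with block size $B$ incurs $$ \Omega\left( \begin{cases} \dfrac{D}{\lg (1+B)} & \text{when } D = O(\lg N), \\[2ex] \dfrac{\lg N}{\lg \left(1+\frac{B \lg N}{D}\right)} & \text{when } D = \Omega(\lg N) \text{ and } D = O(B \lg N), \\[2ex] \dfrac{D}{B} & \text{when } D = \Omega(B \lg N) \end{cases} \right) $$ memory transfers along some root-to-node path of length $D$.
   Context: A fixed-topology tree is a rooted tree whose shape (parent/child structure) is given and may not be changed. An external-memory layout of a tree with $N$ nodes and block size $B$ stores each node exactly once in a linear array; the array is partitioned into consecutive aligned blocks of $B$ positions each. The number of memory transfers incurred along a root-to-node path (visiting the nodes from the root downward in order) is the number of blocks containing nodes of that path. The length $D$ of a root-to-node path is the depth of its final node. $\lg$ denotes the base-2 logarithm.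
   Formalization: In the middle range the bound is proved only when also D = O(N^(1-ε)), for any fixed ε > 0 (constant depending on ε), since it fails e.g. for B = N, D = N/lg N, where one block holds the whole tree; also B ≥ 1 and D < N are assumed so that blocks and paths of length D exist. *)

theory Defs
  imports Complex_Main "HOL-Library.Tree" "HOL-Library.Sublist"
begin

text \<open>The topology of a binary tree is a \<^typ>\<open>unit tree\<close>: its nodes are the \<^const>\<open>Node\<close>
  constructors (so \<^const>\<open>size\<close> counts the nodes), and each node has at most one left and at
  most one right child. A node is named by its address, the sequence of left (\<^const>\<open>False\<close>)
  and right (\<^const>\<open>True\<close>) turns leading to it from the root, so its depth is the length of the
  address and the nodes on the path from the root to it are the prefixes of the address.\<close>

fun nodes :: "'a tree \<Rightarrow> bool list set" where
  "nodes Leaf = {}"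
| "nodes (Node l x r) = insert [] ((#) False ` nodes l \<union> (#) True ` nodes r)"

lemma finite_nodes [simp]: "finite (nodes t)"
  by (induction t) auto

lemma card_nodes [simp]: "card (nodes t) = size t"
proof (induction t)
  case (Node l x r)
  have "card ((#) False ` nodes l \<union> (#) True ` nodes r) = size l + size r"
    using Node by (subst card_Un_disjoint) (auto simp: card_image)
  then show ?case by (subst nodes.simps, subst card_insert_disjoint) auto
qed simp

lemma nodes_prefix_closed: "v \<in> nodes t \<Longrightarrow> prefix u v \<Longrightarrow> u \<in> nodes t"
  by (induction t arbitrary: u v) (auto simp: prefix_Cons)

text \<open>A layout assigns distinct array positions to the nodes. Unused positions are allowed.\<close>

definition is_layout :: "'a tree \<Rightarrow> (bool list \<Rightarrow> nat) \<Rightarrow> bool" where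
  "is_layout t pos \<longleftrightarrow> inj_on pos (nodes t)"

definition transfers :: "nat \<Rightarrow> (bool list \<Rightarrow> nat) \<Rightarrow> bool list \<Rightarrow> nat" where
  "transfers B pos v = card ((\<lambda>u. pos u div B) ` {u. prefix u v})"

text \<open>In the theorem, \<open>K\<close> is the constant hidden in the range conditions; as these become weaker
  when \<open>K\<close> grows, one \<open>K\<close> covers any choice of separate constants. The constant \<open>c\<close> of the lower
  bound depends on \<open>K\<close> and \<open>\<epsilon>\<close> only. Where ranges overlap, all their bounds hold on the same path.

  The bound \<open>lg N / lg (1 + B lg N / D)\<close> of the middle range \<open>D = \<Omega>(lg N)\<close>, \<open>D = O(B lg N)\<close>
  does not hold for paths whose length is too close to the number of nodes: if \<open>B = N\<close> then a
  single block holds the whole tree, yet for \<open>D = N / lg N\<close> the bound is \<open>\<Theta>(lg N / lg lg N)\<close>.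
  This is why the theorem asks for \<open>D = O(N\<^sup>1\<^sup>-\<^sup>\<epsilon>)\<close>, for an arbitrary \<open>\<epsilon> > 0\<close>, in the middle range.
  No such restriction is needed in the other two ranges. The next lemma shows that dropping it
  makes the middle case false, already with all range constants equal to 1.\<close>

lemma unrestricted_middle_range_false:
  "\<not> (\<exists>c>0. \<forall>N B D :: nat. B \<ge> 1 \<longrightarrow> D < N \<longrightarrow>
        log 2 N \<le> D \<longrightarrow> D \<le> B * log 2 N \<longrightarrow>
        (\<exists>t :: unit tree. size t = N \<and>
          (\<forall>pos. is_layout t pos \<longrightarrow>
            (\<exists>v\<in>nodes t. length v = D \<and>
               transfers B pos v \<ge> c * (log 2 N / log 2 (1 + B * log 2 N / D))))))"
proof (intro notI, elim exE conjE)
  fix c :: real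
  assume c: "c > 0"
    and H: "\<forall>N B D :: nat. B \<ge> 1 \<longrightarrow> D < N \<longrightarrow>
        log 2 N \<le> D \<longrightarrow> D \<le> B * log 2 N \<longrightarrow>
        (\<exists>t :: unit tree. size t = N \<and>
          (\<forall>pos. is_layout t pos \<longrightarrow>
            (\<exists>v\<in>nodes t. length v = D \<and>
               transfers B pos v \<ge> c * (log 2 N / log 2 (1 + B * log 2 N / D)))))"
  have "(\<lambda>j::nat. real j / 2 ^ j) \<longlonglongrightarrow> 0"
    using lim_n_over_pown[of "2::real"] by simp
  then have "\<forall>\<^sub>F j in sequentially. real j / 2 ^ j < c / 3"
    using c by (intro order_tendstoD(2)[where y = 0]) auto
  then obtain j0 where j0: "\<And>j. j \<ge> j0 \<Longrightarrow> real j / 2 ^ j < c / 3"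
    unfolding eventually_sequentially by blast
  define j where "j = max 2 j0"
  have j: "j \<ge> 2" "real j / 2 ^ j < c / 3"
    using j0[of j] by (simp_all add: j_def)
  define m where "m = (2::nat) ^ j"
  have jm: "2 * j \<le> m"
    unfolding m_def using j(1) by (induction j rule: dec_induct) auto
  define N D where "N = (2::nat) ^ m" and "D = (2::nat) ^ (m - j)"
  have lgN: "log 2 N = m" by (simp add: N_def)
  have ND: "D * m = N"
  proof -
    have "D * m = 2 ^ (m - j + j)" unfolding D_def power_add by (simp flip: m_def)
    then show ?thesis using jm by (simp add: N_def)
  qed
  have "m \<le> D"
  proof -
    have "(2::nat) ^ j \<le> 2 ^ (m - j)" using jm by (intro power_increasing) auto
    then show ?thesis by (simp only: D_def flip: m_def)
  qed
  moreover have "D < N"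
    unfolding D_def N_def using j(1) jm by (intro power_strict_increasing) auto
  moreover have "D * 1 \<le> N * m"
    using \<open>D < N\<close> j(1) jm by (intro mult_le_mono) auto
  then have "real D \<le> N * log 2 N"
    unfolding lgN by (metis mult.right_neutral of_nat_le_iff of_nat_mult)
  moreover have "N \<ge> 1" by (simp add: N_def)
  moreover have "log 2 N \<le> D" using \<open>m \<le> D\<close> lgN by simp
  ultimately obtain t :: "unit tree" where t: "size t = N" and
    T: "\<And>pos. is_layout t pos \<Longrightarrow> \<exists>v\<in>nodes t. length v = D \<and>
          transfers N pos v \<ge> c * (log 2 N / log 2 (1 + N * log 2 N / D))"
    using H by blast
  obtain pos where pos: "bij_betw pos (nodes t) {0..<N}"
    using ex_bij_betw_finite_nat[OF finite_nodes[of t]] t by auto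
  then have "is_layout t pos" by (simp add: is_layout_def bij_betw_def)
  from T[OF this] obtain v where v: "v \<in> nodes t"
    "transfers N pos v \<ge> c * (log 2 N / log 2 (1 + N * log 2 N / D))"
    by blast
  have "pos u div N = 0" if "prefix u v" for u
  proof -
    have "pos u \<in> {0..<N}"
      using bij_betwE[OF pos] nodes_prefix_closed[OF v(1) that] by blast
    then show ?thesis by (simp only: atLeastLessThan_iff div_less)
  qed
  then have "(\<lambda>u. pos u div N) ` {u. prefix u v} \<subseteq> {0}" by (simp add: image_subset_iff)
  then have "transfers N pos v \<le> card {0::nat}"
    unfolding transfers_def by (intro card_mono) simp_all
  then have "transfers N pos v \<le> 1" by simp
  then have 1: "c * (m / log 2 (1 + real N * real m / D)) \<le> 1"
    using v(2) unfolding lgN by linarith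
  have "D > 0" by (simp add: D_def)
  then have "real N * real m / D = real m ^ 2"
    unfolding ND[symmetric] by (simp add: power2_eq_square)
  moreover have "1 \<le> real m ^ 2" using jm j(1) by simp
  moreover from this have "log 2 (1 + real m ^ 2) \<le> log 2 (2 * real m ^ 2)"
    by (intro log_mono) linarith+
  moreover have "log 2 (2 * real m ^ 2) = 1 + 2 * j"
    by (simp add: m_def log_mult log_nat_power)
  moreover have "0 < log 2 (1 + real m ^ 2)"
    using \<open>1 \<le> real m ^ 2\<close> by (subst zero_less_log_cancel_iff) linarith+
  ultimately have L: "log 2 (1 + real N * real m / D) \<le> 1 + 2 * j"
    "log 2 (1 + real N * real m / D) > 0"
    by (simp_all only:)
  have "c * m \<le> log 2 (1 + real N * real m / D)"
    using 1 L(2) by (simp add: pos_divide_le_eq)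
  with L(1) j(1) have "c * m \<le> 3 * j" by linarith
  moreover have "3 * real j < c * m" using j(2) by (simp add: m_def field_simps)
  ultimately show False by linarith
qed

end

theory Submission
  imports Defs "HOL-Analysis.Convex"
begin

text \<open>Subdivide the edges of a complete binary tree of height \<open>h\<close> so that each of its nodes becomes a
  chain of \<open>p\<close> nodes, and follow a uniformly random root-to-leaf path. A fixed block holds a fraction
  \<open>x u \<in> [0,1]\<close> of each chain \<open>u\<close>, with total \<open>\<Sum> x u \<le> B / p\<close>. By induction on \<open>h\<close>, the expected sum of
  \<open>x u\<close> over the chains on the path is at most \<open>lg (1 + B / p)\<close> times the probability that the
  path meets the block. Summing over all blocks gives \<open>h \<le> lg (1 + B / p) \<cdot> E[number of blocks met]\<close>,
  so some path has at least \<open>h / lg (1 + B / p)\<close> transfers. Taking \<open>h \<approx> min D (lg N)\<close>, up to constant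
  factors, and \<open>p \<approx> D / h\<close> yields the first two ranges; the third one holds for every path of
  length \<open>D\<close>, since a block contains at most \<open>B\<close> nodes.\<close>

section \<open>Random paths: expected weight against hit probability\<close>

text \<open>Expectations and probabilities over a uniformly random path \<open>z\<close> of length \<open>h\<close>: \<open>mean_weight\<close> is the
  expected sum of \<open>x u\<close> over the proper prefixes \<open>u\<close> of \<open>z\<close>, and \<open>hit_prob\<close> is the probability that
  some of these has \<open>x u > 0\<close>.\<close>

fun mean_weight :: "nat \<Rightarrow> (bool list \<Rightarrow> real) \<Rightarrow> real" where
  "mean_weight 0 x = 0"
| "mean_weight (Suc h) x =
     x [] + (mean_weight h (\<lambda>u. x (False # u)) + mean_weight h (\<lambda>u. x (True # u))) / 2"

fun hit_prob :: "nat \<Rightarrow> (bool list \<Rightarrow> real) \<Rightarrow> real" where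
  "hit_prob 0 x = 0"
| "hit_prob (Suc h) x =
     (if x [] > 0 then 1
      else (hit_prob h (\<lambda>u. x (False # u)) + hit_prob h (\<lambda>u. x (True # u))) / 2)"

lemma finite_lists_length_less [simp]: "finite {u :: bool list. length u < h}"
  using finite_lists_length_le[of "UNIV :: bool set" h]
  by (rule rev_finite_subset) auto

lemma sum_lists_length_less_Suc:
  fixes x :: "bool list \<Rightarrow> 'a :: comm_monoid_add"
  shows "(\<Sum>u | length u < Suc h. x u) =
    x [] + ((\<Sum>u | length u < h. x (False # u)) + (\<Sum>u | length u < h. x (True # u)))"
proof -
  have "{u :: bool list. length u < Suc h} =
    insert [] ((#) False ` {u. length u < h} \<union> (#) True ` {u. length u < h})"
    (is "_ = insert [] (?A \<union> ?B)")
    by (auto simp: length_Suc_conv less_Suc_eq_0_disj image_iff)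
  moreover have "sum x (?A \<union> ?B) = sum x ?A + sum x ?B"
    by (intro sum.union_disjoint) auto
  ultimately show ?thesis
    by (simp add: sum.reindex sum.insert image_iff)
qed

lemma hit_prob_bounds: "0 \<le> hit_prob h x" "hit_prob h x \<le> 1"
proof (induction h arbitrary: x)
  case (Suc h)
  { case 1 show ?case using Suc by (simp add: add_nonneg_nonneg) }
  { case 2 show ?case using Suc(2)[of "\<lambda>u. x (False # u)"] Suc(2)[of "\<lambda>u. x (True # u)"] by simp }
qed simp_all

text \<open>Concavity of \<open>ln\<close>: the chord between \<open>1\<close> and
  \<open>1 + y\<close> lies below the graph. With \<open>y = 1\<close> this gives
  \<open>s \<le> log 2 (1 + s)\<close> on the unit interval.\<close>

lemma mult_log2_le:
  assumes "0 \<le> s" "s \<le> 1" "0 \<le> (y::real)"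
  shows "s * log 2 (1 + y) \<le> log 2 (1 + s * y)"
proof -
  have "(1 - s) * ln 1 + s * ln (1 + y) \<le> ln ((1 - s) * 1 + s * (1 + y))"
    using concave_onD[OF ln_concave, of s 1 "1 + y"] assms by simp
  then show ?thesis by (simp add: log_def algebra_simps divide_right_mono)
qed

text \<open>By AM-GM, the average of the two logarithms is at most \<open>log 2 (1 + m)\<close> with
  \<open>m = (a + b) / 2\<close>. The total weight contains \<open>2 * m\<close> rather than
  \<open>m\<close>, and the spare \<open>m\<close> covers the cross term in
  \<open>(1 + x) * (1 + m)\<close>, because \<open>x \<le> 1\<close>.\<close>

lemma log2_node_step:
  fixes x a b :: real
  assumes "0 \<le> x" "x \<le> 1" "0 \<le> a" "0 \<le> b"
  shows "x + (log 2 (1 + a) + log 2 (1 + b)) / 2 \<le> log 2 (1 + (x + (a + b)))"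
proof -
  define m where "m = (a + b) / 2"
  have m: "m \<ge> 0" using assms by (simp add: m_def)
  have "(1 + a) * (1 + b) \<le> (1 + m) ^ 2"
    using zero_le_power2[of "a - b"] unfolding m_def by (simp add: field_simps power2_eq_square)
  then have "log 2 ((1 + a) * (1 + b)) \<le> log 2 ((1 + m) ^ 2)"
    using assms by (intro log_mono) auto
  then have 1: "(log 2 (1 + a) + log 2 (1 + b)) / 2 \<le> log 2 (1 + m)"
    using assms m by (simp add: log_mult log_nat_power)
  have "(1 + x) * (1 + m) \<le> 1 + (x + (a + b))"
    using mult_right_mono[OF assms(2) m] by (simp add: m_def algebra_simps)
  then have "log 2 ((1 + x) * (1 + m)) \<le> log 2 (1 + (x + (a + b)))"
    using m assms by (intro log_mono) auto
  moreover have "x \<le> log 2 (1 + x)"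
    using mult_log2_le[of x 1] assms by simp
  ultimately have "x + log 2 (1 + m) \<le> log 2 (1 + (x + (a + b)))"
    using m assms by (simp add: log_mult)
  with 1 show ?thesis by linarith
qed

text \<open>If the root has positive weight, the target probability is 1, so the subtree
  probabilities may be bounded by 1 and \<open>log2_node_step\<close> applies. Otherwise both sides
  average over the subtrees, after each subtree weight is enlarged to the total
  \<open>a + b\<close>.\<close>

lemma mean_weight_le:
  assumes "\<And>u. 0 \<le> x u" "\<And>u. x u \<le> 1"
  shows "mean_weight h x \<le> log 2 (1 + (\<Sum>u | length u < h. x u)) * hit_prob h x"
  using assms
proof (induction h arbitrary: x)
  case (Suc h)
  define xl xr where "xl = (\<lambda>u. x (False # u))" and "xr = (\<lambda>u. x (True # u))"
  define a b where "a = (\<Sum>u | length u < h. xl u)" and "b = (\<Sum>u | length u < h. xr u)"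
  have ab: "a \<ge> 0" "b \<ge> 0" using Suc.prems by (auto simp: a_def b_def xl_def xr_def intro!: sum_nonneg)
  have IH: "mean_weight h xl \<le> log 2 (1 + a) * hit_prob h xl"
      "mean_weight h xr \<le> log 2 (1 + b) * hit_prob h xr"
    using Suc by (simp_all add: a_def b_def xl_def xr_def)
  have W: "(\<Sum>u | length u < Suc h. x u) = x [] + (a + b)"
    by (simp add: sum_lists_length_less_Suc a_def b_def xl_def xr_def del: length_0_conv)
  have E: "mean_weight (Suc h) x = x [] + (mean_weight h xl + mean_weight h xr) / 2"
    by (simp add: xl_def xr_def)
  show ?case
  proof (cases "x [] > 0")
    case True
    have "mean_weight h xl \<le> log 2 (1 + a)" "mean_weight h xr \<le> log 2 (1 + b)"
      using IH mult_left_le[of "hit_prob h xl" "log 2 (1 + a)"]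
        mult_left_le[of "hit_prob h xr" "log 2 (1 + b)"] ab hit_prob_bounds by fastforce+
    then have "mean_weight (Suc h) x \<le> log 2 (1 + (x [] + (a + b)))"
      using log2_node_step[OF Suc.prems ab, of "[]"] unfolding E by argo
    then show ?thesis
      unfolding W using True by simp
  next
    case False
    then have x0: "x [] = 0" using Suc.prems(1)[of "[]"] by simp
    have "mean_weight h xl \<le> log 2 (1 + (a + b)) * hit_prob h xl"
      "mean_weight h xr \<le> log 2 (1 + (a + b)) * hit_prob h xr"
      using ab by (auto intro!: order.trans[OF IH(1)] order.trans[OF IH(2)] mult_right_mono hit_prob_bounds)
    then show ?thesis using x0 unfolding W
      by (simp add: algebra_simps flip: xl_def xr_def)
  qed
qed simp

text \<open>Linearity of expectation: a path of length \<open>h\<close> has \<open>h\<close> proper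
  prefixes, and at each of them the weights over \<open>C\<close> add up to 1.\<close>

lemma mean_weight_sum:
  assumes "finite C" "\<And>u. length u < h \<Longrightarrow> (\<Sum>b\<in>C. x b u) = 1"
  shows "(\<Sum>b\<in>C. mean_weight h (x b)) = h"
  using assms(2)
proof (induction h arbitrary: x)
  case (Suc h)
  have "(\<Sum>b\<in>C. mean_weight h (\<lambda>u. x b (c # u))) = h" for c
    using Suc by simp
  then show ?case using Suc.prems[of "[]"]
    by (simp add: sum.distrib flip: sum_divide_distrib)
qed simp

text \<open>Method of conditional expectations: some path meets at least as many indices of
  \<open>C\<close> as a random path does on average. Indices met at the root are counted and set
  aside; for the others, the path enters the child with the larger expectation.\<close>

lemma exists_path_many_hits:
  assumes "finite C"
  shows "\<exists>z. length z = h \<and>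
    (\<Sum>b\<in>C. hit_prob h (x b)) \<le> card {b \<in> C. \<exists>u. strict_prefix u z \<and> x b u > 0}"
  using assms
proof (induction h arbitrary: x C)
  case (Suc h)
  define C1 C0 where "C1 = {b \<in> C. x b [] > 0}" and "C0 = {b \<in> C. \<not> x b [] > 0}"
  have fin: "finite C1" "finite C0" and C: "C = C1 \<union> C0" "C1 \<inter> C0 = {}"
    using Suc.prems by (auto simp: C1_def C0_def)
  define s where "s a = (\<Sum>b\<in>C0. hit_prob h (\<lambda>u. x b (a # u)))" for a
  have "(\<Sum>b\<in>C. hit_prob (Suc h) (x b)) =
      (\<Sum>b\<in>C1. hit_prob (Suc h) (x b)) + (\<Sum>b\<in>C0. hit_prob (Suc h) (x b))"
    using C fin by (simp only: sum.union_disjoint)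
  also have "(\<Sum>b\<in>C1. hit_prob (Suc h) (x b)) = card C1"
    by (simp add: C1_def)
  also have "(\<Sum>b\<in>C0. hit_prob (Suc h) (x b)) = (s False + s True) / 2"
    by (simp add: C0_def s_def sum.distrib flip: sum_divide_distrib)
  finally have eq: "(\<Sum>b\<in>C. hit_prob (Suc h) (x b)) = card C1 + (s False + s True) / 2" .
  obtain a where "(s False + s True) / 2 \<le> s a"
    using that[of False] that[of True] by argo
  moreover obtain z where z: "length z = h"
      "s a \<le> card {b \<in> C0. \<exists>u. strict_prefix u z \<and> x b (a # u) > 0}" (is "_ \<le> real (card ?H)")
    using Suc.IH[OF fin(2), of "\<lambda>b u. x b (a # u)"] unfolding s_def by blast
  moreover have "card C1 + card ?H = card (C1 \<union> ?H)"
    using fin C by (intro card_Un_disjoint[symmetric]) auto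
  moreover have "card (C1 \<union> ?H) \<le> card {b \<in> C. \<exists>u. strict_prefix u (a # z) \<and> x b u > 0}"
  proof (intro card_mono subsetI)
    fix b assume "b \<in> C1 \<union> ?H"
    then obtain u where "strict_prefix u (a # z)" "x b u > 0" "b \<in> C"
      unfolding C1_def C0_def by (auto intro: that[of "[]"] that[of "a # _"])
    then show "b \<in> {b \<in> C. \<exists>u. strict_prefix u (a # z) \<and> x b u > 0}" by blast
  qed (use Suc.prems in simp)
  ultimately have "(\<Sum>b\<in>C. hit_prob (Suc h) (x b)) \<le>
      card {b \<in> C. \<exists>u. strict_prefix u (a # z) \<and> x b u > 0}"
    unfolding eq by linarith
  with z(1) show ?case by (intro exI[of _ "a # z"]) simp
qed simp

section \<open>Trees that contain prescribed paths\<close>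

fun grow :: "unit tree \<Rightarrow> unit tree" where
  "grow Leaf = Node Leaf () Leaf"
| "grow (Node l x r) = Node (grow l) x r"

lemma size_grow [simp]: "size (grow t) = Suc (size t)"
  by (induction t) auto

lemma nodes_grow: "nodes t \<subseteq> nodes (grow t)"
  by (induction t) auto

text \<open>Padding to exactly \<open>N\<close> nodes: growing at the left end keeps every existing
  address.\<close>

lemma exists_tree_extend:
  fixes t :: "unit tree"
  assumes "size t \<le> N"
  shows "\<exists>t' :: unit tree. nodes t \<subseteq> nodes t' \<and> size t' = N"
proof -
  have "nodes t \<subseteq> nodes ((grow ^^ k) t) \<and> size ((grow ^^ k) t) = size t + k" for k
    by (induction k) (use nodes_grow in auto)
  from this[of "N - size t"] assms show ?thesis
    by (intro exI[of _ "(grow ^^ (N - size t)) t"]) simp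
qed

lemma exists_tree_insert_path: "\<exists>t' :: unit tree. nodes t' = nodes t \<union> {u. prefix u v}"
  for t :: "unit tree"
proof (induction v arbitrary: t)
  case Nil
  show ?case
  proof (cases t)
    case Leaf then show ?thesis by (intro exI[of _ "Node Leaf () Leaf"]) auto
  next
    case (Node l x r) then show ?thesis by (intro exI[of _ t]) auto
  qed
next
  case (Cons a v)
  \<comment> \<open>A leaf is treated as having two empty subtrees, so that missing nodes are
    created on the way down. Adding \<open>[]\<close> below makes the decomposition valid in this
    case too.\<close>
  define l where "l = (case t of Leaf \<Rightarrow> Leaf | Node l _ _ \<Rightarrow> l)"
  define r where "r = (case t of Leaf \<Rightarrow> Leaf | Node _ _ r \<Rightarrow> r)"
  have t: "nodes t \<union> {[]} = insert [] ((#) False ` nodes l \<union> (#) True ` nodes r)"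
    by (cases t) (auto simp: l_def r_def)
  have v: "{u. prefix u (a # v)} = insert [] ((#) a ` {u. prefix u v})"
    by (auto simp: prefix_Cons)
  obtain l' :: "unit tree" where l': "nodes l' = nodes l \<union> {u. prefix u v}" using Cons by blast
  obtain r' :: "unit tree" where r': "nodes r' = nodes r \<union> {u. prefix u v}" using Cons by blast
  have "nodes t \<union> {u. prefix u (a # v)} = (nodes t \<union> {[]}) \<union> (#) a ` {u. prefix u v}"
    unfolding v by simp
  also have "\<dots> = nodes (if a then Node l () r' else Node l' () r)"
    unfolding t by (cases a) (simp_all add: l' r' image_Un Un_ac)
  finally have "nodes (if a then Node l () r' else Node l' () r) = nodes t \<union> {u. prefix u (a # v)}"
    by (rule sym)
  then show ?case by blast
qed

lemma finite_prefixes [simp]: "finite {u. prefix u v}"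
  and card_prefixes: "card {u. prefix u v} = Suc (length v)"
  by (simp_all flip: set_prefixes_eq add: distinct_card)

text \<open>Crude count: each inserted path adds at most \<open>Suc D\<close> nodes, and the nodes
  that paths share are not discounted.\<close>

lemma exists_tree_containing:
  assumes "finite V" "\<And>v. v \<in> V \<Longrightarrow> length v = D"
  shows "\<exists>t :: unit tree. V \<subseteq> nodes t \<and> size t \<le> card V * Suc D"
  using assms
proof (induction V rule: finite_induct)
  case (insert v V)
  then obtain t :: "unit tree" where t: "V \<subseteq> nodes t" "size t \<le> card V * Suc D" by auto
  obtain t' :: "unit tree" where t': "nodes t' = nodes t \<union> {u. prefix u v}"
    using exists_tree_insert_path by blast
  have "size t' \<le> size t + Suc D"
    using card_Un_le[of "nodes t" "{u. prefix u v}"] insert.prems by (simp add: card_prefixes flip: t')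
  then show ?case using t t' insert.hyps by (intro exI[of _ t']) auto
qed (auto intro: exI[of _ Leaf])

lemma exists_tree_containing_size:
  assumes "finite V" "\<And>v. v \<in> V \<Longrightarrow> length v = D" "card V * Suc D \<le> N"
  shows "\<exists>t :: unit tree. V \<subseteq> nodes t \<and> size t = N"
  using exists_tree_containing[OF assms(1,2)] exists_tree_extend assms(3) by (meson order.trans)


section \<open>Addresses in the subdivided tree\<close>

text \<open>The chain that replaces node \<open>u\<close> of the complete tree consists of \<open>chain_node q u i\<close> for \<open>i \<le> q\<close>,
  so it has \<open>Suc q\<close> nodes, and only its last node branches.\<close>

fun spread :: "nat \<Rightarrow> bool list \<Rightarrow> bool list" where
  "spread q [] = []"
| "spread q (a # w) = replicate q False @ a # spread q w"

lemma length_spread [simp]: "length (spread q w) = Suc q * length w"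
  by (induction w) auto

lemma spread_append: "spread q (u @ v) = spread q u @ spread q v"
  by (induction u) auto

lemma spread_inject: "spread q u = spread q v \<Longrightarrow> u = v"
proof (induction u arbitrary: v)
  case Nil
  then show ?case by (cases v) auto
next
  case (Cons a u)
  then show ?case by (cases v) auto
qed

definition chain_node :: "nat \<Rightarrow> bool list \<Rightarrow> nat \<Rightarrow> bool list" where
  "chain_node q u i = spread q u @ replicate i False"

text \<open>Since \<open>i \<le> q\<close>, the length of the address modulo \<open>Suc q\<close>
  recovers \<open>i\<close>; the common suffix then cancels and \<open>spread\<close> is
  injective.\<close>

lemma chain_node_inject:
  assumes "chain_node q u i = chain_node q v j" "i \<le> q" "j \<le> q"
  shows "u = v \<and> i = j"
proof -
  have "Suc q * length u + i = Suc q * length v + j"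
    using arg_cong[OF assms(1), of length] by (simp add: chain_node_def)
  then have "(Suc q * length u + i) mod Suc q = (Suc q * length v + j) mod Suc q"
    by metis
  then have "i = j"
    using assms(2,3) by (simp only: mod_mult_self4) simp
  with assms(1) show ?thesis
    by (auto simp: chain_node_def dest: spread_inject)
qed

text \<open>As the prefix is strict, a further turn of \<open>z\<close> follows \<open>u\<close>,
  and \<open>spread\<close> puts \<open>q\<close> left turns before it. These run along the chain of
  \<open>u\<close>.\<close>

lemma chain_node_prefix:
  assumes "strict_prefix u z" "i \<le> q"
  shows "prefix (chain_node q u i) (spread q z)"
proof -
  from assms(1) obtain a w where z: "z = u @ a # w" by (rule strict_prefixE')
  have "replicate q False = replicate i False @ replicate (q - i) False"
    using assms(2) by (simp flip: replicate_add)
  then show ?thesis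
    unfolding z spread_append chain_node_def by (simp add: prefix_def)
qed

lemma finite_card_block:
  assumes "(B :: nat) > 0"
  shows "finite {m. m div B = b}" "card {m. m div B = b} = B"
proof -
  have "m div B = b \<longleftrightarrow> b * B \<le> m \<and> m < Suc b * B" for m
    unfolding less_eq_div_iff_mult_less_eq[OF assms, symmetric]
      div_less_iff_less_mult[OF assms, symmetric]
    by linarith
  then have "{m. m div B = b} = {b * B..<Suc b * B}"
    by (simp only: atLeastLessThan_def atLeast_def lessThan_def Int_def mem_Collect_eq)
  then show "finite {m. m div B = b}" "card {m. m div B = b} = B" by simp_all
qed

section \<open>Lower bound for the subdivided tree\<close>

text \<open>\<open>Suc q\<close> is the chain length \<open>p\<close> of the idea above. The case
  \<open>h = 0\<close> merely supplies a tree on \<open>N\<close> nodes with a node at depth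
  \<open>D\<close>.\<close>

lemma subdivided_tree_lower_bound:
  fixes h q D N B :: nat
  assumes B: "B \<ge> 1" and D: "h * Suc q \<le> D" and N: "2 ^ h * Suc D \<le> N"
  shows "\<exists>t :: unit tree. size t = N \<and> (\<forall>pos. is_layout t pos \<longrightarrow>
    (\<exists>v\<in>nodes t. length v = D \<and> h \<le> transfers B pos v * log 2 (1 + B / Suc q)))"
proof -
  \<comment> \<open>The left turns at the end bring the path to length exactly
    \<open>D\<close>.\<close>
  define P where "P z = spread q z @ replicate (D - h * Suc q) False" for z
  define Z where "Z = {z :: bool list. length z = h}"
  have Z: "finite Z" "card Z = 2 ^ h"
    using finite_lists_length_eq[of "UNIV :: bool set" h] card_lists_length_eq[of "UNIV :: bool set" h]
    by (simp_all add: Z_def)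
  have len: "length (P z) = D" if "z \<in> Z" for z
    using that D by (simp add: P_def Z_def mult.commute)
  have "card (P ` Z) * Suc D \<le> 2 ^ h * Suc D"
    using card_image_le[OF Z(1), of P] Z(2) by (intro mult_right_mono) auto
  then obtain t :: "unit tree" where t: "P ` Z \<subseteq> nodes t" "size t = N"
    using exists_tree_containing_size[of "P ` Z" D N] Z(1) len N by fastforce
  have pre: "prefix (chain_node q u i) (P z)" if "strict_prefix u z" "i \<le> q" for u z i
    using chain_node_prefix[OF that] by (simp add: P_def)
  have mem: "chain_node q u i \<in> nodes t" if "length u < h" "i \<le> q" for u i
  proof -
    define z where "z = u @ replicate (h - length u) False"
    have "strict_prefix u z" "z \<in> Z"
      using that by (auto simp: z_def Z_def strict_prefix_def)
    then show ?thesis using pre[OF _ that(2)] t(1) by (blast intro: nodes_prefix_closed)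
  qed
  have "\<exists>v\<in>nodes t. length v = D \<and> h \<le> transfers B pos v * log 2 (1 + B / Suc q)"
    if "is_layout t pos" for pos
  proof -
    \<comment> \<open>\<open>col\<close> is the block of a node, and \<open>x b u\<close> is the
      fraction of the chain of \<open>u\<close> that lies in block \<open>b\<close>.\<close>
    define col where "col u = pos u div B" for u
    define C where "C = col ` nodes t"
    define I where "I b u = {i. i \<le> q \<and> col (chain_node q u i) = b}" for b u
    define x where "x b u = card (I b u) / Suc q" for b u
    have finI: "finite (I b u)" for b u by (simp add: I_def)
    have x: "0 \<le> x b u" "x b u \<le> 1" for b u
    proof -
      have "card (I b u) \<le> card {..q}" by (intro card_mono) (auto simp: I_def)
      then show "0 \<le> x b u" "x b u \<le> 1" by (simp_all add: x_def)
    qed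
    have x1: "(\<Sum>b\<in>C. x b u) = 1" if "length u < h" for u
    proof -
      have "(\<Union>b\<in>C. I b u) = {..q}"
        using mem[OF that] by (auto simp: C_def I_def)
      moreover have "card (\<Union>b\<in>C. I b u) = (\<Sum>b\<in>C. card (I b u))"
        by (intro card_UN_disjoint) (auto simp: C_def I_def)
      ultimately have "(\<Sum>b\<in>C. card (I b u)) = Suc q" by simp
      then have "(\<Sum>b\<in>C. real (card (I b u))) = Suc q" by (simp flip: of_nat_sum)
      then show ?thesis by (simp add: x_def flip: sum_divide_distrib)
    qed
    \<comment> \<open>Distinct chain nodes occupy distinct positions, and block \<open>b\<close> has
      only \<open>B\<close> of them.\<close>
    have W: "(\<Sum>u | length u < h. x b u) \<le> B / Suc q" for b
    proof -
      let ?S = "SIGMA u:{u. length u < h}. I b u"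
      have "inj_on (\<lambda>(u, i). pos (chain_node q u i)) ?S"
        using that mem
        by (auto simp: inj_on_def is_layout_def I_def dest!: chain_node_inject)
      moreover have "(\<lambda>(u, i). pos (chain_node q u i)) ` ?S \<subseteq> {m. m div B = b}"
        by (auto simp: I_def col_def)
      ultimately have "card ?S \<le> B"
        using card_inj_on_le[of _ ?S "{m. m div B = b}"] finite_card_block[of B b] B by auto
      then have "(\<Sum>u | length u < h. card (I b u)) \<le> B"
        by (subst (asm) card_SigmaI) (auto simp: finI)
      then have "(\<Sum>u | length u < h. real (card (I b u))) \<le> B"
        by (simp flip: of_nat_sum)
      then show ?thesis by (simp add: x_def divide_right_mono flip: sum_divide_distrib)
    qed
    let ?L = "log 2 (1 + B / Suc q)"
    have L: "?L \<ge> 0" by (simp add: zero_le_log_cancel_iff add_pos_nonneg)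
    have "h = (\<Sum>b\<in>C. mean_weight h (x b))"
      using mean_weight_sum[of C h x] x1 by (simp add: C_def)
    also have "\<dots> \<le> (\<Sum>b\<in>C. ?L * hit_prob h (x b))"
    proof (rule sum_mono)
      fix b
      have "mean_weight h (x b) \<le> log 2 (1 + (\<Sum>u | length u < h. x b u)) * hit_prob h (x b)"
        by (intro mean_weight_le x)
      also have "\<dots> \<le> ?L * hit_prob h (x b)"
        using W[of b] x
        by (intro mult_right_mono hit_prob_bounds log_mono) (auto intro!: add_pos_nonneg sum_nonneg)
      finally show "mean_weight h (x b) \<le> ?L * hit_prob h (x b)" .
    qed
    finally have h: "h \<le> (\<Sum>b\<in>C. hit_prob h (x b)) * ?L"
      by (simp add: sum_distrib_right mult.commute)
    obtain z where z: "length z = h"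
      "(\<Sum>b\<in>C. hit_prob h (x b)) \<le> card {b \<in> C. \<exists>u. strict_prefix u z \<and> x b u > 0}"
      using exists_path_many_hits[of C h x] by (auto simp: C_def)
    \<comment> \<open>A positive fraction means that some node of the chain of \<open>u\<close> lies
      in \<open>b\<close>, and this node is on the path to \<open>P z\<close>.\<close>
    have "{b \<in> C. \<exists>u. strict_prefix u z \<and> x b u > 0} \<subseteq> col ` {u. prefix u (P z)}"
    proof clarsimp
      fix b u
      assume "strict_prefix u z" "x b u > 0"
      then have "I b u \<noteq> {}" by (auto simp: x_def)
      with \<open>strict_prefix u z\<close> pre show "b \<in> col ` {u. prefix u (P z)}"
        unfolding I_def by blast
    qed
    then have "card {b \<in> C. \<exists>u. strict_prefix u z \<and> x b u > 0} \<le> transfers B pos (P z)"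
      unfolding transfers_def col_def by (intro card_mono) simp_all
    with z(2) have "(\<Sum>b\<in>C. hit_prob h (x b)) \<le> transfers B pos (P z)" by linarith
    from order.trans[OF h mult_right_mono[OF this L]]
    show ?thesis using z(1) t(1) len by (intro bexI[of _ "P z"]) (auto simp: Z_def)
  qed
  with t(2) show ?thesis by blast
qed

section \<open>Bounds valid on every path\<close>

lemma transfers_ge_one: "transfers B pos v \<ge> 1"
proof -
  have "(\<lambda>u. pos u div B) ` {u. prefix u v} \<noteq> {}" by auto
  then show ?thesis unfolding transfers_def by (simp add: Suc_le_eq card_gt_0_iff)
qed

text \<open>Pigeonhole: the nodes on the path have distinct positions, and each block visited offers
  \<open>B\<close> positions. This is the bound for the third range.\<close>

lemma transfers_ge_length_div:
  assumes "is_layout t pos" "v \<in> nodes t" "B \<ge> 1"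
  shows "length v / B \<le> transfers B pos v"
proof -
  let ?V = "{u. prefix u v}" and ?C = "(\<lambda>u. pos u div B) ` {u. prefix u v}"
  have inj: "inj_on pos ?V"
    using assms(1)[unfolded is_layout_def]
    by (rule inj_on_subset) (simp add: subset_iff nodes_prefix_closed[OF assms(2)])
  have "pos ` ?V \<subseteq> (\<Union>b\<in>?C. {m. m div B = b})" by auto
  then have "card (pos ` ?V) \<le> card (\<Union>b\<in>?C. {m. m div B = b})"
    using finite_card_block assms(3) by (intro card_mono) auto
  also have "\<dots> \<le> (\<Sum>b\<in>?C. card {m. m div B = b})"
    by (intro card_UN_le) simp
  also have "\<dots> = transfers B pos v * B"
    using finite_card_block assms(3) by (simp add: transfers_def)
  finally have "length v \<le> transfers B pos v * B"
    using inj by (simp add: card_image card_prefixes)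
  then have "real (length v) \<le> transfers B pos v * B"
    by (metis of_nat_le_iff of_nat_mult)
  then show ?thesis using assms(3) by (simp add: pos_divide_le_eq)
qed


section \<open>Logarithm estimates and choice of parameters\<close>

text \<open>Concavity with factor \<open>1 / a\<close>; it moves constant factors out of
  logarithms.\<close>

lemma log2_mult_le:
  assumes "a \<ge> 1" "y \<ge> (0::real)"
  shows "log 2 (1 + a * y) \<le> a * log 2 (1 + y)"
proof -
  have "1 / a * log 2 (1 + a * y) \<le> log 2 (1 + 1 / a * (a * y))"
    using assms by (intro mult_log2_le) auto
  also have "1 / a * (a * y) = y" using assms by simp
  finally show ?thesis using assms by (simp add: pos_divide_le_eq mult.commute)
qed

text \<open>The tangent to \<open>ln\<close> at 2, together with
  \<open>1 / 2 \<le> ln 2 \<le> 1\<close>.\<close>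

lemma log2_le_self:
  assumes "x > (0::real)"
  shows "log 2 x \<le> x"
proof -
  have "ln (x / 2) \<le> x / 2 - 1" using assms by (intro ln_le_minus_one) simp
  then have "ln x \<le> x / 2 - 1 + ln 2" using assms by (simp add: ln_div)
  moreover have "(1 / 2) * x \<le> ln 2 * x" "ln (2::real) \<le> 1"
    using ln_le_minus_one[of "1 / 2 :: real"] ln_le_minus_one[of "2 :: real"] assms
    by (simp_all add: ln_div)
  ultimately have "ln x \<le> ln 2 * x" by argo
  then show ?thesis by (simp add: log_def pos_divide_le_eq mult.commute)
qed

lemma balanced_tree_lower_bound:
  fixes h D N B :: nat
  assumes "B \<ge> 1" "h \<ge> 1" "h \<le> D" "2 ^ h * Suc D \<le> N"
  shows "\<exists>t :: unit tree. size t = N \<and> (\<forall>pos. is_layout t pos \<longrightarrow>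
    (\<exists>v\<in>nodes t. length v = D \<and> h \<le> transfers B pos v * log 2 (1 + B * (2 * real h / D))))"
proof -
  \<comment> \<open>With \<open>Suc q = D div h\<close>, the \<open>h\<close> chains fit into length
    \<open>D\<close> and leave fewer than \<open>h\<close> nodes over. This rounding costs at most
    the factor 2 in \<open>2 * real h / D\<close>.\<close>
  define q where "q = D div h - 1"
  have q: "Suc q = D div h" using assms by (simp add: q_def div_greater_zero_iff)
  have le: "h * Suc q \<le> D" unfolding q by simp
  have "D < h * Suc q + h"
    unfolding q using assms dividend_less_times_div[of h D] by simp
  also have "\<dots> \<le> 2 * h * Suc q" by simp
  finally have "real D \<le> 2 * h * Suc q"
    by (metis less_imp_le of_nat_le_iff of_nat_mult of_nat_numeral)
  then have "1 / Suc q \<le> 2 * real h / D" using assms(2,3) by (simp add: field_simps)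
  then have "B * (1 / Suc q) \<le> B * (2 * real h / D)" by (intro mult_left_mono) simp_all
  then have "log 2 (1 + B / Suc q) \<le> log 2 (1 + B * (2 * real h / D))"
    by (intro log_mono) (auto intro: add_pos_nonneg)
  then have le_log: "transfers B pos v * log 2 (1 + B / Suc q) \<le>
      transfers B pos v * log 2 (1 + B * (2 * real h / D))" for pos v
    by (intro mult_left_mono) simp_all
  from subdivided_tree_lower_bound[OF assms(1) le assms(4)] obtain t :: "unit tree"
    where "size t = N" "\<And>pos. is_layout t pos \<Longrightarrow> \<exists>v\<in>nodes t. length v = D \<and>
      h \<le> transfers B pos v * log 2 (1 + B / Suc q)"
    by blast
  then show ?thesis using order.trans[OF _ le_log] by blast
qed

text \<open>One tree and one path serve both ranges. For large \<open>L\<close>, the height is about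
  \<open>\<delta> * L\<close>: if \<open>D\<close> is at most this height, the tree has height
  \<open>D\<close> and chains of one node, otherwise \<open>D\<close> is divided evenly among the
  chains.\<close>

lemma lower_bound_short_and_middle:
  fixes K \<delta> Q L A :: real and N B D :: nat
  defines "L \<equiv> log 2 N" and "A \<equiv> log 2 (2 * K) + 1"
  assumes K: "K \<ge> 1" and \<delta>: "0 < \<delta>" "\<delta> \<le> 1 / 2"
    and Q: "Q = 8 * K * (A + 1) / \<delta>\<^sup>2"
    and B: "B \<ge> 1" and D: "1 \<le> D" "D < N"
  shows "\<exists>t :: unit tree. size t = N \<and> (\<forall>pos. is_layout t pos \<longrightarrow>
    (\<exists>v\<in>nodes t. length v = D \<and>
      (D \<le> K * L \<longrightarrow> D / log 2 (1 + real B) \<le> Q * transfers B pos v) \<and>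
      (L \<le> K * D \<and> D \<le> K * (B * L) \<and> D \<le> K * N powr (1 - \<delta>) \<longrightarrow>
        L / log 2 (1 + B * L / D) \<le> Q * transfers B pos v)))"
    (is "\<exists>t. ?size t \<and> (\<forall>pos. ?layout t pos \<longrightarrow> ?bound t pos)")
proof -
  have A: "A \<ge> 1" using K by (simp add: A_def)
  have L: "L > 0" using D by (simp add: L_def)
  have lB: "log 2 (1 + real B) \<ge> 1" using B by (simp add: le_log_iff)
  have \<delta>sq: "\<delta>\<^sup>2 \<le> \<delta>" using \<delta> by (simp add: power2_eq_square)
  have KA: "1 \<le> K * (A + 1)" "K \<le> K * (A + 1)"
    using K A mult_mono[of 1 K 1 "A + 1"] by simp_all
  \<comment> \<open>\<open>Q\<close> dominates the constants of all cases: \<open>Q1\<close> serves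
    bounded \<open>L\<close>, \<open>QK\<close> serves chains of one node, and \<open>Q4\<close> and
    \<open>Q8\<close> serve the balanced tree.\<close>
  have Q1: "8 * K * (A + 1) / \<delta> \<le> Q" unfolding Q using \<delta> \<delta>sq K A
    by (intro divide_left_mono) auto
  have "8 * K * (A + 1) * 1 \<le> 8 * K * (A + 1) * (1 / \<delta>)"
    using \<delta> K A by (intro mult_left_mono) (auto simp: le_divide_eq)
  then have "8 * K * (A + 1) \<le> 8 * K * (A + 1) / \<delta>" by simp
  with Q1 KA have QK: "K \<le> Q" by linarith
  have Q4: "4 / \<delta> \<le> Q"
    using KA(1) \<delta> by (intro order.trans[OF divide_right_mono Q1]) auto
  have Q8: "8 * K / \<delta>\<^sup>2 \<le> Q"
    using KA(2) \<delta> unfolding Q by (intro divide_right_mono) auto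
  have Q0: "Q \<ge> 0" using QK K by linarith
  have "B * L / D > 0" using B L D by simp
  then have mpos: "log 2 (1 + B * L / D) > 0"
    by (subst zero_less_log_cancel_iff) linarith+
  show ?thesis
  proof (cases "L > 2 * (A + 1) / \<delta> \<and> (D \<le> K * L \<or> D \<le> K * N powr (1 - \<delta>))")
    case False
    \<comment> \<open>Both bounds are vacuous or at most the constant \<open>Q\<close>, so that a single transfer suffices.\<close>
    obtain t :: "unit tree" where t: "size t = N" "\<And>pos. is_layout t pos \<Longrightarrow>
        \<exists>v\<in>nodes t. length v = D"
      using subdivided_tree_lower_bound[OF B, of 0 0 D N] D by force
    have "(D \<le> K * L \<longrightarrow> D / log 2 (1 + real B) \<le> Q * transfers B pos v) \<and>
      (L \<le> K * D \<and> D \<le> K * (B * L) \<and> D \<le> K * N powr (1 - \<delta>) \<longrightarrow>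
        L / log 2 (1 + B * L / D) \<le> Q * transfers B pos v)" for pos v
    proof -
      have "Q * 1 \<le> Q * transfers B pos v"
        using transfers_ge_one[of B pos v] Q0 by (intro mult_left_mono) simp_all
      then have QT: "Q \<le> Q * transfers B pos v" by simp
      have KL: "K * L \<le> Q" if "L \<le> 2 * (A + 1) / \<delta>"
      proof -
        have "K * L \<le> K * (2 * (A + 1) / \<delta>)" using that K by (intro mult_left_mono) auto
        also have "\<dots> \<le> 8 * K * (A + 1) / \<delta>"
          using K A \<delta> by (simp add: divide_right_mono)
        finally show ?thesis using Q1 by linarith
      qed
      have "D / log 2 (1 + real B) \<le> Q" if "D \<le> K * L"
      proof -
        have "D / log 2 (1 + real B) \<le> D / 1" using lB by (intro divide_left_mono) auto
        moreover have "K * L \<le> Q" using False that by (intro KL) auto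
        ultimately show ?thesis using that by simp
      qed
      moreover have "L / log 2 (1 + B * L / D) \<le> Q"
        if "D \<le> K * (B * L)" "D \<le> K * N powr (1 - \<delta>)"
      proof -
        \<comment> \<open>The range condition keeps the denominator at least \<open>1 / K\<close>,
          so the middle bound is at most \<open>K * L\<close>.\<close>
        have "1 / K \<le> B * L / D" using that(1) K D by (simp add: field_simps)
        then have "log 2 (1 + 1 / K * 1) \<le> log 2 (1 + B * L / D)"
          using K by (intro log_mono) (auto intro: add_pos_nonneg)
        then have "1 / K \<le> log 2 (1 + B * L / D)"
          using mult_log2_le[of "1 / K" 1] K by simp
        then have "L / log 2 (1 + B * L / D) \<le> L / (1 / K)"
          using L K mpos by (intro divide_left_mono) auto
        moreover have "K * L \<le> Q" using False that by (intro KL) auto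
        ultimately show ?thesis by (simp add: mult.commute)
      qed
      ultimately show ?thesis using QT by linarith
    qed
    with t show ?thesis by blast
  next
    case True
    \<comment> \<open>This height leaves room for \<open>2 ^ h0\<close> paths of
      \<open>Suc D\<close> nodes, once \<open>1 + D\<close> is bounded by
      \<open>2 powr ((1 - \<delta>) * L + A)\<close>. Here \<open>A\<close> equals
      \<open>log 2 (4 * K)\<close>.\<close>
    define h0 where "h0 = nat \<lfloor>\<delta> * L - A\<rfloor>"
    have "log 2 (1 + D) \<le> (1 - \<delta>) * L + A"
    proof (cases "D \<le> K * L")
      case True
      then have "log 2 (1 + D) \<le> log 2 (2 * K * L)" using D by (intro log_mono) auto
      also have "\<dots> = log 2 (2 * K * 2) + log 2 (L / 2)"
        using log_mult[of 2 "2 * K * 2" "L / 2"] K L by (simp add: mult.assoc)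
      also have "log 2 (L / 2) \<le> L / 2"
        using L by (intro log2_le_self) simp
      also have "log 2 (2 * K * 2) = A" using K by (subst log_mult) (auto simp: A_def)
      also have "L / 2 \<le> (1 - \<delta>) * L" using \<delta> L by simp
      finally show ?thesis by simp
    next
      case False
      with True have "real D \<le> K * N powr (1 - \<delta>)" by simp
      then have "log 2 (1 + D) \<le> log 2 (2 * K * N powr (1 - \<delta>))"
        using D by (intro log_mono) auto
      also have "\<dots> = log 2 (2 * K) + (1 - \<delta>) * L"
        using K D by (subst log_mult) (auto simp: log_powr L_def)
      finally show ?thesis by (simp add: A_def)
    qed
    then have logD: "log 2 (1 + D) + (\<delta> * L - A) \<le> L" by (simp add: algebra_simps)
    \<comment> \<open>Rounding down and subtracting \<open>A\<close> together lose at most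
      \<open>A + 1\<close>, which is less than half of \<open>\<delta> * L\<close>.\<close>
    have "\<delta> * L > 2 * (A + 1)" using True \<delta> by (simp add: field_simps)
    then have h0: "real h0 \<le> \<delta> * L - A" "\<delta> * L / 2 \<le> real h0" "h0 \<ge> 1"
      using A unfolding h0_def by (simp_all, linarith+)
    have h0L: "real h0 \<le> L"
    proof -
      have "\<delta> * L \<le> 1 * L" using \<delta> L by (intro mult_right_mono) auto
      with h0(1) A show ?thesis by linarith
    qed
    have "2 ^ h0 * Suc D \<le> N"
    proof -
      have "real (2 ^ h0 * Suc D) = 2 powr (h0 + log 2 (1 + D))"
        by (simp add: powr_add powr_realpow distrib_left)
      also have "\<dots> \<le> 2 powr L" using logD h0(1) by simp
      also have "\<dots> = N" using D by (simp add: L_def)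
      finally show ?thesis by (simp only: of_nat_le_iff)
    qed
    show ?thesis
    proof (cases "D \<le> h0")
      case True
      have "2 ^ D * Suc D \<le> 2 ^ h0 * Suc D" using True by (intro mult_right_mono power_increasing) auto
      with \<open>2 ^ h0 * Suc D \<le> N\<close> have "2 ^ D * Suc D \<le> N" by linarith
      then obtain t :: "unit tree" where t: "size t = N" "\<And>pos. is_layout t pos \<Longrightarrow>
          \<exists>v\<in>nodes t. length v = D \<and> D \<le> transfers B pos v * log 2 (1 + real B)"
        using subdivided_tree_lower_bound[OF B, of D 0 D N] by auto
      have "D / log 2 (1 + real B) \<le> Q * transfers B pos v \<and>
          (L \<le> K * D \<longrightarrow> L / log 2 (1 + B * L / D) \<le> Q * transfers B pos v)"
        if "D \<le> transfers B pos v * log 2 (1 + real B)" for pos v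
      proof -
        have 1: "D / log 2 (1 + real B) \<le> transfers B pos v"
          using that lB by (simp add: divide_le_eq)
        have KT: "K * transfers B pos v \<le> Q * transfers B pos v"
          "1 * real (transfers B pos v) \<le> Q * transfers B pos v"
          using QK K by (intro mult_right_mono; simp)+
        have "L / log 2 (1 + B * L / D) \<le> Q * transfers B pos v" if "L \<le> K * D"
        proof -
          \<comment> \<open>Because \<open>D \<le> L\<close> here, the denominator of the middle
            range is at least that of the short range, so the short bound implies the middle
            one.\<close>
          have "real B * D \<le> B * L" using True h0L by (intro mult_left_mono) auto
          then have "B \<le> B * L / D" using D by (simp add: le_divide_eq)
          then have "log 2 (1 + real B) \<le> log 2 (1 + B * L / D)" by (intro log_mono) auto
          then have "L / log 2 (1 + B * L / D) \<le> L / log 2 (1 + real B)"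
            using lB L mpos by (intro divide_left_mono mult_pos_pos) linarith+
          also have "\<dots> \<le> K * D / log 2 (1 + real B)" using that lB by (intro divide_right_mono) auto
          also have "\<dots> \<le> K * transfers B pos v"
            using mult_left_mono[OF 1, of K] K by simp
          finally show ?thesis using KT by linarith
        qed
        then show ?thesis using 1 KT by linarith
      qed
      with t(2) have "\<forall>pos. ?layout t pos \<longrightarrow> ?bound t pos" by blast
      with t(1) show ?thesis by blast
    next
      case False
      then have hD: "h0 \<le> D" by simp
      obtain t :: "unit tree" where t: "size t = N" "\<And>pos. is_layout t pos \<Longrightarrow>
          \<exists>v\<in>nodes t. length v = D \<and> h0 \<le> transfers B pos v * log 2 (1 + B * (2 * real h0 / D))"
        using balanced_tree_lower_bound[OF B h0(3) hD \<open>2 ^ h0 * Suc D \<le> N\<close>] by auto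
      let ?m = "log 2 (1 + B * L / D)"
      have "B * (2 * real h0 / D) \<le> 2 * (B * L / D)"
        using h0L D B by (simp add: divide_right_mono)
      then have "log 2 (1 + B * (2 * real h0 / D)) \<le> log 2 (1 + 2 * (B * L / D))"
        by (intro log_mono) (auto intro: add_pos_nonneg)
      also have "\<dots> \<le> 2 * ?m" using L by (intro log2_mult_le) auto
      finally have m: "log 2 (1 + B * (2 * real h0 / D)) \<le> 2 * ?m" .
      \<comment> \<open>Now \<open>D\<close> is at least of order \<open>L\<close>, so
        \<open>?m\<close> is at most a constant times \<open>log 2 (1 + real B)\<close>. This lets
        the middle bound imply the short one when \<open>D \<le> K * L\<close>.\<close>
      have "\<delta> * L / 2 \<le> D" using h0(2) hD by linarith
      then have "L / D \<le> 2 / \<delta>" using D \<delta> by (simp add: field_simps)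
      then have "B * (L / D) \<le> B * (2 / \<delta>)" by (intro mult_left_mono) auto
      then have "?m \<le> log 2 (1 + 2 / \<delta> * B)"
        using L by (intro log_mono) (auto intro: add_pos_nonneg simp: mult.commute)
      also have "\<dots> \<le> 2 / \<delta> * log 2 (1 + real B)"
        using \<delta> by (intro log2_mult_le) (auto simp: le_divide_eq)
      finally have m2: "?m \<le> 2 / \<delta> * log 2 (1 + real B)" .
      have "(D \<le> K * L \<longrightarrow> D / log 2 (1 + real B) \<le> Q * transfers B pos v) \<and>
          L / ?m \<le> Q * transfers B pos v"
        if h: "h0 \<le> transfers B pos v * log 2 (1 + B * (2 * real h0 / D))" for pos v
      proof -
        let ?T = "real (transfers B pos v)"
        have "\<delta> * L / 2 \<le> ?T * (2 * ?m)"
          using h0(2) h mult_left_mono[OF m, of ?T] by linarith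
        then have Lm: "L / ?m \<le> 4 / \<delta> * ?T" using mpos \<delta> by (simp add: field_simps)
        have QT: "4 / \<delta> * ?T \<le> Q * ?T" "8 * K / \<delta>\<^sup>2 * ?T \<le> Q * ?T"
          using Q4 Q8 by (intro mult_right_mono; simp)+
        have "D / log 2 (1 + real B) \<le> Q * ?T" if "D \<le> K * L"
        proof -
          have "1 / log 2 (1 + real B) \<le> 2 / \<delta> / ?m"
            using m2 mpos lB \<delta> by (simp add: field_simps)
          then have "D * (1 / log 2 (1 + real B)) \<le> K * L * (2 / \<delta> / ?m)"
            using that lB K L by (intro mult_mono) auto
          also have "\<dots> = 2 * K / \<delta> * (L / ?m)" by simp
          also have "\<dots> \<le> 2 * K / \<delta> * (4 / \<delta> * ?T)"
            using Lm K \<delta> by (intro mult_left_mono) auto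
          also have "\<dots> = 8 * K / \<delta>\<^sup>2 * ?T" by (simp add: power2_eq_square)
          finally show ?thesis using QT by simp
        qed
        with Lm QT show ?thesis by linarith
      qed
      with t(2) have "\<forall>pos. ?layout t pos \<longrightarrow> ?bound t pos" by blast
      with t(1) show ?thesis by blast
    qed
  qed
qed

text \<open>Replacing \<open>K\<close> by \<open>max K 1\<close> and \<open>\<epsilon>\<close> by
  \<open>min \<epsilon> (1 / 2)\<close> only weakens the range conditions. The path found for the
  first two ranges satisfies the third bound as well, since every path of length \<open>D\<close>
  does.\<close>

theorem theorem3:
  fixes K \<epsilon> :: real
  assumes "K > 0" and "\<epsilon> > 0"
  shows "\<exists>c>0. \<forall>N B D :: nat. B \<ge> 1 \<longrightarrow> D < N \<longrightarrow>
    (\<exists>t :: unit tree. size t = N \<and>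
      (\<forall>pos. is_layout t pos \<longrightarrow>
        (\<exists>v\<in>nodes t. length v = D \<and>
          (D \<le> K * log 2 N \<longrightarrow>
             transfers B pos v \<ge> c * (D / log 2 (1 + B))) \<and>
          (log 2 N \<le> K * D \<and> D \<le> K * (B * log 2 N) \<and> D \<le> K * N powr (1 - \<epsilon>) \<longrightarrow>
             transfers B pos v \<ge> c * (log 2 N / log 2 (1 + B * log 2 N / D))) \<and>
          (B * log 2 N \<le> K * D \<longrightarrow>
             transfers B pos v \<ge> c * (D / B)))))"
proof -
  define K' where "K' = max K 1"
  define \<delta> where "\<delta> = min \<epsilon> (1 / 2)"
  define Q where "Q = 8 * K' * (log 2 (2 * K') + 1 + 1) / \<delta>\<^sup>2"
  have K': "K \<le> K'" "1 \<le> K'" by (simp_all add: K'_def)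
  have \<delta>: "0 < \<delta>" "\<delta> \<le> 1 / 2" "\<delta> \<le> \<epsilon>" using assms(2) by (simp_all add: \<delta>_def)
  have lK: "log 2 (2 * K') \<ge> 0" using K' by simp
  then have "log 2 (2 * K') + 1 + 1 > 0" by linarith
  then have "Q > 0" using K' \<delta> unfolding Q_def by (intro divide_pos_pos mult_pos_pos) auto
  have Q: "1 \<le> Q"
  proof -
    have "1 * 1 \<le> 8 * K' * (log 2 (2 * K') + 1 + 1)"
      using K' lK by (intro mult_mono) linarith+
    moreover have "\<delta>\<^sup>2 \<le> 1" using \<delta> by (simp add: power_le_one)
    ultimately show ?thesis using \<delta> unfolding Q_def by (simp add: le_divide_eq)
  qed
  show ?thesis
  proof (intro exI[of _ "1 / Q"] conjI allI impI)
    show "0 < 1 / Q" using \<open>Q > 0\<close> by simp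
  next
    fix N B D :: nat
    assume B: "B \<ge> 1" and D: "D < N"
    have scale: "1 / Q * X \<le> T" if "X \<le> Q * T" for X T
      using that \<open>Q > 0\<close> by (simp add: divide_le_eq mult.commute)
    have hyps: "x \<le> K' * y" if "x \<le> K * y" "y \<ge> 0" for x y
      using that K' mult_right_mono[of K K' y] by linarith
    have L: "log 2 N \<ge> 0" using D by simp
    have "N powr (1 - \<epsilon>) \<le> N powr (1 - \<delta>)" using D \<delta> by (intro powr_mono) auto
    then have "K' * N powr (1 - \<epsilon>) \<le> K' * N powr (1 - \<delta>)"
      using K' by (intro mult_left_mono) auto
    then have hyp_powr: "x \<le> K' * N powr (1 - \<delta>)" if "x \<le> K * N powr (1 - \<epsilon>)" for x
      using hyps[OF that] by simp
    have "\<exists>t :: unit tree. size t = N \<and> (\<forall>pos. is_layout t pos \<longrightarrow>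
      (\<exists>v\<in>nodes t. length v = D \<and>
        (D \<le> K' * log 2 N \<longrightarrow> D / log 2 (1 + real B) \<le> Q * transfers B pos v) \<and>
        (log 2 N \<le> K' * D \<and> D \<le> K' * (B * log 2 N) \<and> D \<le> K' * N powr (1 - \<delta>) \<longrightarrow>
          log 2 N / log 2 (1 + B * log 2 N / D) \<le> Q * transfers B pos v)))"
    proof (cases "D = 0")
      \<comment> \<open>For \<open>D = 0\<close> both bounds are 0: division by zero yields 0, so
        the denominator of the middle bound is \<open>log 2 1 = 0\<close>, and the quotient is again
        0.\<close>
      case True
      then show ?thesis
        using subdivided_tree_lower_bound[OF B, of 0 0 D N] D \<open>Q > 0\<close> by simp
    next
      case False
      then show ?thesis
        using lower_bound_short_and_middle[OF K'(2) \<delta>(1,2) Q_def B _ D] by simp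
    qed
    then obtain t :: "unit tree" where t: "size t = N" and
      T: "\<And>pos. is_layout t pos \<Longrightarrow> \<exists>v\<in>nodes t. length v = D \<and>
        (D \<le> K' * log 2 N \<longrightarrow> D / log 2 (1 + real B) \<le> Q * transfers B pos v) \<and>
        (log 2 N \<le> K' * D \<and> D \<le> K' * (B * log 2 N) \<and> D \<le> K' * N powr (1 - \<delta>) \<longrightarrow>
          log 2 N / log 2 (1 + B * log 2 N / D) \<le> Q * transfers B pos v)"
      by blast
    show "\<exists>t :: unit tree. size t = N \<and>
      (\<forall>pos. is_layout t pos \<longrightarrow>
        (\<exists>v\<in>nodes t. length v = D \<and>
          (D \<le> K * log 2 N \<longrightarrow>
             transfers B pos v \<ge> 1 / Q * (D / log 2 (1 + real B))) \<and>
          (log 2 N \<le> K * D \<and> D \<le> K * (B * log 2 N) \<and> D \<le> K * N powr (1 - \<epsilon>) \<longrightarrow>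
             transfers B pos v \<ge> 1 / Q * (log 2 N / log 2 (1 + B * log 2 N / D))) \<and>
          (B * log 2 N \<le> K * D \<longrightarrow>
             transfers B pos v \<ge> 1 / Q * (D / B))))"
    proof (intro exI[of _ t] conjI t allI impI)
      fix pos
      assume pos: "is_layout t pos"
      from T[OF this] obtain v where v: "v \<in> nodes t" "length v = D"
        "D \<le> K' * log 2 N \<Longrightarrow> D / log 2 (1 + real B) \<le> Q * transfers B pos v"
        "log 2 N \<le> K' * D \<Longrightarrow> D \<le> K' * (B * log 2 N) \<Longrightarrow> D \<le> K' * N powr (1 - \<delta>) \<Longrightarrow>
          log 2 N / log 2 (1 + B * log 2 N / D) \<le> Q * transfers B pos v"
        by blast
      have "1 * real (transfers B pos v) \<le> Q * transfers B pos v"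
        using Q by (intro mult_right_mono) auto
      then have "D / B \<le> Q * transfers B pos v"
        using transfers_ge_length_div[OF pos v(1) B] v(2) by simp
      with v L show "\<exists>v\<in>nodes t. length v = D \<and>
          (D \<le> K * log 2 N \<longrightarrow>
             transfers B pos v \<ge> 1 / Q * (D / log 2 (1 + real B))) \<and>
          (log 2 N \<le> K * D \<and> D \<le> K * (B * log 2 N) \<and> D \<le> K * N powr (1 - \<epsilon>) \<longrightarrow>
             transfers B pos v \<ge> 1 / Q * (log 2 N / log 2 (1 + B * log 2 N / D))) \<and>
          (B * log 2 N \<le> K * D \<longrightarrow>
             transfers B pos v \<ge> 1 / Q * (D / B))"
        by (intro bexI[of _ v] conjI impI scale v(3,4) hyp_powr hyps) auto
    qed
  qed
qed

end
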